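(* A complete-convex \(2\)-edge-coloured graph is either a monochromatic copy of \(K_2\) or has minimum degree at least \(3\).
   Context: A \(2\)-edge-coloured graph is a pair \((G,c_G)\), \(G\) a connected graph with at least two vertices and no parallel edges, \(c_G:E_G\to\{R,B\}\). A path \(u,v,w\) with \(uv,vw\in E_G\), \(u\ne v\ne w\), is an alternating \(2\)-path with centre \(v\) if \(c_G(uv)\ne c_G(vw)\). A vertex set \(S\) is convex if no vertex outside \(S\) is the centre of an alternating \(2\)-path with both ends in \(S\); \(conv(S)\) is the smallest convex superset of \(S\). \((G,c_G)\) is complete convex if \(conv(\{u,v\})=V_G\) for every edge \(uv\). *)

theory Defs
  imports Complex_Main "HOL-Library.Extended_Nat" "HOL.Hull"
begin

datatype colour = Red | Blue

text \<open>
  Edges are two-element subsets of the vertex set, so there are neither loops nor parallel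
  edges. Graphs are not required to be finite. A 2-edge-coloured graph is a connected graph
  together with an arbitrary colouring, given as a total function \<open>c\<close> on sets of vertices of
  which only the values on edges matter.
\<close>

definition adj_rel :: "'a set set \<Rightarrow> ('a \<times> 'a) set" where
  "adj_rel E = {(u, v). {u, v} \<in> E}"

locale connected_graph =
  fixes V :: "'a set" and E :: "'a set set"
  assumes edges: "\<And>e. e \<in> E \<Longrightarrow> e \<subseteq> V \<and> card e = 2"
    and two_vertices: "\<exists>u\<in>V. \<exists>v\<in>V. u \<noteq> v"
    and connected: "\<And>u v. u \<in> V \<Longrightarrow> v \<in> V \<Longrightarrow> (u, v) \<in> (adj_rel E)\<^sup>*"

definition alternating_2path ::
    "'a set set \<Rightarrow> ('a set \<Rightarrow> colour) \<Rightarrow> 'a \<Rightarrow> 'a \<Rightarrow> 'a \<Rightarrow> bool" where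
  "alternating_2path E c u v w \<longleftrightarrow>
     {u, v} \<in> E \<and> {v, w} \<in> E \<and> u \<noteq> v \<and> v \<noteq> w \<and> c {u, v} \<noteq> c {v, w}"

definition convex_set :: "'a set \<Rightarrow> 'a set set \<Rightarrow> ('a set \<Rightarrow> colour) \<Rightarrow> 'a set \<Rightarrow> bool" where
  "convex_set V E c S \<longleftrightarrow>
     S \<subseteq> V \<and> \<not> (\<exists>v\<in>V - S. \<exists>u\<in>S. \<exists>w\<in>S. alternating_2path E c u v w)"

definition conv :: "'a set \<Rightarrow> 'a set set \<Rightarrow> ('a set \<Rightarrow> colour) \<Rightarrow> 'a set \<Rightarrow> 'a set" where
  "conv V E c S = convex_set V E c hull S"

text \<open>For a set of vertices, this hull is indeed the smallest convex superset.\<close>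

lemma convex_set_conv:
  assumes "S \<subseteq> V"
  shows "convex_set V E c (conv V E c S)"
proof -
  have V: "convex_set V E c V"
    by (simp add: convex_set_def)
  have "conv V E c S \<subseteq> V"
    unfolding conv_def using assms V by (rule hull_minimal)
  moreover have "\<not> alternating_2path E c u v w"
    if v: "v \<in> V - conv V E c S" and uw: "u \<in> conv V E c S" "w \<in> conv V E c S" for u v w
  proof -
    from v obtain T where T: "convex_set V E c T" "S \<subseteq> T" "v \<notin> T"
      by (auto simp: conv_def hull_def)
    then have "conv V E c S \<subseteq> T"
      by (simp add: conv_def hull_minimal)
    with uw have "u \<in> T" "w \<in> T"
      by (simp_all add: subsetD)
    with T v show ?thesis
      by (simp add: convex_set_def)
  qed
  ultimately show ?thesis
    unfolding convex_set_def by simp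
qed

lemma subset_conv: "S \<subseteq> conv V E c S"
  unfolding conv_def by (rule hull_subset)

lemma conv_least: "convex_set V E c T \<Longrightarrow> S \<subseteq> T \<Longrightarrow> conv V E c S \<subseteq> T"
  unfolding conv_def by (rule hull_minimal)

definition complete_convex :: "'a set \<Rightarrow> 'a set set \<Rightarrow> ('a set \<Rightarrow> colour) \<Rightarrow> bool" where
  "complete_convex V E c \<longleftrightarrow> (\<forall>u v. {u, v} \<in> E \<longrightarrow> conv V E c {u, v} = V)"

definition is_K2 :: "'a set \<Rightarrow> 'a set set \<Rightarrow> bool" where
  "is_K2 V E \<longleftrightarrow> (\<exists>u v. u \<noteq> v \<and> V = {u, v} \<and> E = {{u, v}})"

definition monochromatic :: "'a set set \<Rightarrow> ('a set \<Rightarrow> colour) \<Rightarrow> bool" where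
  "monochromatic E c \<longleftrightarrow> (\<exists>k. \<forall>e\<in>E. c e = k)"

text \<open>
  Degrees are extended naturals because \<^const>\<open>card\<close> would give a vertex with infinitely many
  incident edges degree 0.
\<close>

definition degree :: "'a set set \<Rightarrow> 'a \<Rightarrow> enat" where
  "degree E v =
     (if finite {e \<in> E. v \<in> e} then enat (card {e \<in> E. v \<in> e}) else \<infinity>)"

definition min_degree :: "'a set \<Rightarrow> 'a set set \<Rightarrow> enat" where
  "min_degree V E = (INF v\<in>V. degree E v)"

end

theory Submission
  imports Defs
begin

text \<open>
  A convex set containing an edge is all of \<open>V\<close>. If the edges at \<open>v\<close> all have one colour, then
  \<open>V - {v}\<close> is convex, so it contains no edge and the graph is a star with centre \<open>v\<close>; in a star
  every edge is convex, so the graph is \<open>K\<^sub>2\<close>. If exactly two edges \<open>va\<close>, \<open>vb\<close> meet \<open>v\<close> and their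
  colours differ, only \<open>b\<close> can be the centre of an alternating 2-path between \<open>a\<close> and \<open>v\<close>, so
  \<open>ab\<close> is an edge coloured unlike \<open>vb\<close>; symmetrically it is coloured unlike \<open>va\<close>, which is
  impossible with two colours.
\<close>

lemma convex_set_edge_eq:
  assumes "complete_convex V E c" "convex_set V E c S" "{u, v} \<in> E" "u \<in> S" "v \<in> S"
  shows "S = V"
proof -
  have "V \<subseteq> S"
    using assms conv_least[of V E c S "{u, v}"] by (simp add: complete_convex_def)
  then show ?thesis
    using assms(2) by (auto simp: convex_set_def)
qed

text \<open>An alternating 2-path with equal ends would use one edge twice, so its two colours would
  agree; only \<open>a\<close> and \<open>b\<close> as distinct ends remain.\<close>

lemma convex_set_edge_iff:
  assumes "{a, b} \<subseteq> V"
  shows "convex_set V E c {a, b} \<longleftrightarrow>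
    \<not> (\<exists>x\<in>V - {a, b}. {a, x} \<in> E \<and> {b, x} \<in> E \<and> c {a, x} \<noteq> c {b, x})"
  using assms by (auto simp: convex_set_def alternating_2path_def insert_commute)

context connected_graph
begin

lemma edgeD:
  assumes "{u, v} \<in> E"
  shows "u \<in> V" "v \<in> V" "u \<noteq> v"
  using edges[OF assms] by auto

lemma ex_edge: "\<exists>u v. {u, v} \<in> E"
proof -
  obtain u v where "u \<in> V" "v \<in> V" "u \<noteq> v"
    using two_vertices by blast
  then have "(u, v) \<in> (adj_rel E)\<^sup>*" "u \<noteq> v"
    using connected by auto
  then show ?thesis
    by (cases rule: converse_rtranclE) (auto simp: adj_rel_def)
qed

lemma monochromatic_vertex_K2:
  assumes cc: "complete_convex V E c" and v: "v \<in> V"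
    and mono: "\<And>a b. {v, a} \<in> E \<Longrightarrow> {v, b} \<in> E \<Longrightarrow> c {v, a} = c {v, b}"
  shows "is_K2 V E \<and> monochromatic E c"
proof -
  have "convex_set V E c (V - {v})"
    using mono by (auto simp: convex_set_def alternating_2path_def insert_commute)
  then have star: "x = v \<or> y = v" if "{x, y} \<in> E" for x y
    using convex_set_edge_eq[OF cc _ that] edgeD[OF that] v by blast
  obtain a where a: "{v, a} \<in> E"
    using ex_edge star by (metis insert_commute)
  note av = edgeD[OF a]
  \<comment> \<open>A centre \<open>x\<close> would give an edge \<open>{a, x}\<close> avoiding
    \<open>v\<close>, against \<open>star\<close>.\<close>
  have "convex_set V E c {v, a}"
    using star av by (auto simp: convex_set_edge_iff)
  then have V: "V = {v, a}"
    using convex_set_edge_eq[OF cc _ a] by blast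
  have "e = {v, a}" if "e \<in> E" for e
    using edges[OF that] V av by (intro card_subset_eq) auto
  with a have "E = {{v, a}}"
    by blast
  with V av show ?thesis
    by (auto simp: is_K2_def monochromatic_def)
qed

lemma degree_two_closing_edge:
  assumes cc: "complete_convex V E c"
    and va: "{v, a} \<in> E" and vb: "{v, b} \<in> E" and "a \<noteq> b"
    and only: "\<And>x. {v, x} \<in> E \<Longrightarrow> x = a \<or> x = b"
  shows "c {a, b} \<noteq> c {v, b}"
proof -
  note in_V = edgeD[OF va] edgeD[OF vb]
  have "{v, a} \<noteq> V"
    using in_V \<open>a \<noteq> b\<close> by auto
  then have "\<not> convex_set V E c {v, a}"
    using convex_set_edge_eq[OF cc _ va] by auto
  then obtain x where "x \<noteq> a" "{v, x} \<in> E" "c {v, x} \<noteq> c {a, x}"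
    using in_V by (auto simp: convex_set_edge_iff)
  \<comment> \<open>As a neighbour of \<open>v\<close> other than \<open>a\<close>, \<open>x\<close>
    must be \<open>b\<close>.\<close>
  with only show ?thesis
    by metis
qed

lemma degree_ge_3:
  assumes cc: "complete_convex V E c" and v: "v \<in> V"
    and not_K2: "\<not> (is_K2 V E \<and> monochromatic E c)"
  shows "degree E v \<ge> 3"
proof (rule ccontr)
  let ?I = "{e \<in> E. v \<in> e}"
  assume "\<not> degree E v \<ge> 3"
  \<comment> \<open>Infinitely many edges at \<open>v\<close> would give degree \<infinity>.\<close>
  then have fin: "finite ?I" and card: "card ?I \<le> 2"
    by (auto simp: degree_def numeral_eq_enat split: if_splits)
  \<comment> \<open>At most one edge at \<open>v\<close> would be trivially one-coloured, so degrees
    0 and 1 are excluded here too.\<close>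
  obtain a b where va: "{v, a} \<in> E" and vb: "{v, b} \<in> E" and ne: "c {v, a} \<noteq> c {v, b}"
    using monochromatic_vertex_K2[OF cc v] not_K2 by blast
  then have ab: "a \<noteq> b" and distinct: "{v, a} \<noteq> {v, b}"
    by auto
  \<comment> \<open>Two distinct edges already exhaust the bound \<open>card\<close>.\<close>
  have I: "{{v, a}, {v, b}} = ?I"
    using va vb card distinct by (intro card_seteq[OF fin]) auto
  have only: "x = a \<or> x = b" if "{v, x} \<in> E" for x
  proof -
    have "{v, x} \<in> {{v, a}, {v, b}}"
      unfolding I using that by simp
    then show ?thesis
      by (auto simp: doubleton_eq_iff)
  qed
  have "c {a, b} \<noteq> c {v, b}"
    using degree_two_closing_edge[OF cc va vb ab only] .
  moreover have "c {a, b} \<noteq> c {v, a}"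
    using degree_two_closing_edge[OF cc vb va ab[symmetric]] only
    by (metis insert_commute)
  ultimately show False
    using ne by (cases "c {a, b}"; cases "c {v, a}"; cases "c {v, b}") simp_all
qed

end

theorem theorem14:
  fixes V :: "'a set" and E :: "'a set set" and c :: "'a set \<Rightarrow> colour"
  assumes "connected_graph V E"
    and "complete_convex V E c"
  shows "(is_K2 V E \<and> monochromatic E c) \<or> min_degree V E \<ge> 3"
  using connected_graph.degree_ge_3[OF assms] by (auto simp: min_degree_def intro: INF_greatest)

end
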